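(* Let $\psi\in\mathcal{D}$ be a DQBF and let $\psi_1=\forall x:(\varphi_1\wedge\varphi_2)$ be a subformula of $\psi$. Let $x'$ be a fresh variable not occurring in $\psi$, and let $\psi'$ result from $\psi$ by replacing the subformula $\psi_1$ by $\psi_2=(\forall x:\varphi_1)\wedge(\forall x':\varphi_2[x'/x])$, where $\varphi_2[x'/x]$ replaces all occurrences of $x$ by $x'$, including occurrences in dependency sets. Then $\psi$ and $\psi'$ are equisatisfiable.
   Context: Notation: $\mathcal{F}(W)$ is the set of Boolean functions over variable set $W$; $\mathrm{supp}(f)$ the set of variables $f$ depends on. Syntax (non-closed non-prenex DQBFs in NNF over a finite variable set $V$). The set $\mathcal{D}$, with for each $\psi$ the sets $V^{\exists}_\psi$ (existential), $V^{\forall}_\psi$ (universal), $V^{\mathrm{fs}}_\psi$ (free variables occurring in $\psi$), and a dependency set $D_y\subseteq V$ for each existential $y$, is the smallest set closed under: (1) $v\in\mathcal{D}$ for $v\in V$ ($V^\exists=V^\forall=\emptyset$, $V^{\mathrm{fs}}=\{v\}$); (2) $\neg v\in\mathcal{D}$, same sets; (3),(4) if $\varphi_1,\varphi_2\in\mathcal{D}$ and $\bigl(V^Q_{\varphi_1}\cup V^{\mathrm{fs}}_{\varphi_1}\cup\bigcup_{y\in V^\exists_{\varphi_1}}D_y\bigr)\cap V^Q_{\varphi_2}=\emptyset$ and symmetrically, then $(\varphi_1\wedge\varphi_2),(\varphi_1\vee\varphi_2)\in\mathcal{D}$ with all three sets the unions; (5) if $\varphi\in\mathcal{D}$, $v\in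 V^{\mathrm{free}}_\varphi$, $D_v\subseteq V\setminus(V^Q_\varphi\cup\{v\})$, then $\exists v(D_v):\varphi^{-v}\in\mathcal{D}$ ($\varphi^{-v}$: remove $v$ from all dependency sets in $\varphi$), with $V^\exists=V^\exists_\varphi\cup\{v\}$, $V^{\mathrm{fs}}=V^{\mathrm{fs}}_\varphi\setminus\{v\}$; (6) if $\varphi\in\mathcal{D}$, $v\in V^{\mathrm{free}}_\varphi$, then $\forall v:\varphi\in\mathcal{D}$ with $V^\forall=V^\forall_\varphi\cup\{v\}$, $V^{\mathrm{fs}}=V^{\mathrm{fs}}_\varphi\setminus\{v\}$. Here $V^Q_\psi=V^\exists_\psi\cup V^\forall_\psi$, $V_\psi=V^Q_\psi\cup V^{\mathrm{fs}}_\psi$, $V^{\mathrm{free}}_\psi=V\setminus V^Q_\psi$. Semantics. A Skolem function candidate for $\psi$ is a map $s:V^{\mathrm{free}}_\psi\cup V^\exists_\psi\to\mathcal{F}(V^\forall_\psi)$ with $s(v)$ constant for free $v$ and $\mathrm{supp}(s(v))\subseteq D_v\cap V^\forall_\psi$ for existential $v$. $s(\psi)$ replaces each such $v$ by $s(v)$ and deletes quantifiers. $[\![\psi]\!]$ is the set of candidates $s$ with $s(\psi)$ a tautology. $\psi_1\approx\psi_2$ (equisatisfiable) iff $[\![\psi_1]\!]=\emptyset\Leftrightarrow[\![\psi_2]\!]=\emptyset$. *)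

theory Defs
  imports Main "HOL-Library.FuncSet"
begin

datatype 'v dqbf =
    Pos 'v
  | Neg 'v
  | And "'v dqbf" "'v dqbf"
  | Or "'v dqbf" "'v dqbf"
  | Exists 'v "'v set" "'v dqbf"
  | Forall 'v "'v dqbf"

primrec ex_vars :: "'v dqbf \<Rightarrow> 'v set" where
  "ex_vars (Pos v) = {}"
| "ex_vars (Neg v) = {}"
| "ex_vars (And \<phi>1 \<phi>2) = ex_vars \<phi>1 \<union> ex_vars \<phi>2"
| "ex_vars (Or \<phi>1 \<phi>2) = ex_vars \<phi>1 \<union> ex_vars \<phi>2"
| "ex_vars (Exists v D \<phi>) = ex_vars \<phi> \<union> {v}"
| "ex_vars (Forall v \<phi>) = ex_vars \<phi>"

primrec all_vars :: "'v dqbf \<Rightarrow> 'v set" where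
  "all_vars (Pos v) = {}"
| "all_vars (Neg v) = {}"
| "all_vars (And \<phi>1 \<phi>2) = all_vars \<phi>1 \<union> all_vars \<phi>2"
| "all_vars (Or \<phi>1 \<phi>2) = all_vars \<phi>1 \<union> all_vars \<phi>2"
| "all_vars (Exists v D \<phi>) = all_vars \<phi>"
| "all_vars (Forall v \<phi>) = all_vars \<phi> \<union> {v}"

(* The free variables with an occurrence as a literal. A variable that is mentioned only in
   dependency sets does not count. *)
primrec fs_vars :: "'v dqbf \<Rightarrow> 'v set" where
  "fs_vars (Pos v) = {v}"
| "fs_vars (Neg v) = {v}"
| "fs_vars (And \<phi>1 \<phi>2) = fs_vars \<phi>1 \<union> fs_vars \<phi>2"
| "fs_vars (Or \<phi>1 \<phi>2) = fs_vars \<phi>1 \<union> fs_vars \<phi>2"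
| "fs_vars (Exists v D \<phi>) = fs_vars \<phi> - {v}"
| "fs_vars (Forall v \<phi>) = fs_vars \<phi> - {v}"

definition q_vars :: "'v dqbf \<Rightarrow> 'v set" where
  "q_vars \<psi> = ex_vars \<psi> \<union> all_vars \<psi>"

definition vars :: "'v dqbf \<Rightarrow> 'v set" where
  "vars \<psi> = q_vars \<psi> \<union> fs_vars \<psi>"

definition free_vars :: "'v set \<Rightarrow> 'v dqbf \<Rightarrow> 'v set" where
  "free_vars V \<psi> = V - q_vars \<psi>"

(* In a well-formed formula every existential variable y is bound by exactly one quantifier,
   so dep \<psi> y is the dependency set annotated at that quantifier; the unions below merely
   select the branch that binds y. *)
primrec dep :: "'v dqbf \<Rightarrow> 'v \<Rightarrow> 'v set" where
  "dep (Pos v) y = {}"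
| "dep (Neg v) y = {}"
| "dep (And \<phi>1 \<phi>2) y = dep \<phi>1 y \<union> dep \<phi>2 y"
| "dep (Or \<phi>1 \<phi>2) y = dep \<phi>1 y \<union> dep \<phi>2 y"
| "dep (Exists v D \<phi>) y = (if y = v then D else dep \<phi> y)"
| "dep (Forall v \<phi>) y = dep \<phi> y"

definition dep_vars :: "'v dqbf \<Rightarrow> 'v set" where
  "dep_vars \<psi> = (\<Union>y\<in>ex_vars \<psi>. dep \<psi> y)"

(* \<phi> with v removed from all dependency sets *)
primrec remove_dep :: "'v \<Rightarrow> 'v dqbf \<Rightarrow> 'v dqbf" where
  "remove_dep v (Pos u) = Pos u"
| "remove_dep v (Neg u) = Neg u"
| "remove_dep v (And \<phi>1 \<phi>2) = And (remove_dep v \<phi>1) (remove_dep v \<phi>2)"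
| "remove_dep v (Or \<phi>1 \<phi>2) = Or (remove_dep v \<phi>1) (remove_dep v \<phi>2)"
| "remove_dep v (Exists u D \<phi>) = Exists u (D - {v}) (remove_dep v \<phi>)"
| "remove_dep v (Forall u \<phi>) = Forall u (remove_dep v \<phi>)"

definition compatible :: "'v dqbf \<Rightarrow> 'v dqbf \<Rightarrow> bool" where
  "compatible \<phi>1 \<phi>2 \<longleftrightarrow>
     (q_vars \<phi>1 \<union> fs_vars \<phi>1 \<union> dep_vars \<phi>1) \<inter> q_vars \<phi>2 = {} \<and>
     (q_vars \<phi>2 \<union> fs_vars \<phi>2 \<union> dep_vars \<phi>2) \<inter> q_vars \<phi>1 = {}"

inductive_set DQBF :: "'v set \<Rightarrow> 'v dqbf set" for V :: "'v set" where
  pos: "v \<in> V \<Longrightarrow> Pos v \<in> DQBF V"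
| neg: "v \<in> V \<Longrightarrow> Neg v \<in> DQBF V"
| conj: "\<phi>1 \<in> DQBF V \<Longrightarrow> \<phi>2 \<in> DQBF V \<Longrightarrow> compatible \<phi>1 \<phi>2 \<Longrightarrow> And \<phi>1 \<phi>2 \<in> DQBF V"
| disj: "\<phi>1 \<in> DQBF V \<Longrightarrow> \<phi>2 \<in> DQBF V \<Longrightarrow> compatible \<phi>1 \<phi>2 \<Longrightarrow> Or \<phi>1 \<phi>2 \<in> DQBF V"
| exist: "\<phi> \<in> DQBF V \<Longrightarrow> v \<in> free_vars V \<phi> \<Longrightarrow> D \<subseteq> V - (q_vars \<phi> \<union> {v}) \<Longrightarrow>
    Exists v D (remove_dep v \<phi>) \<in> DQBF V"
| univ: "\<phi> \<in> DQBF V \<Longrightarrow> v \<in> free_vars V \<phi> \<Longrightarrow> Forall v \<phi> \<in> DQBF V"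

(* A Boolean function over a set W of variables is represented as a function of total
   assignments whose value is determined by the restriction of the assignment to W. *)
type_synonym 'v bfun = "('v \<Rightarrow> bool) \<Rightarrow> bool"

definition bfuns :: "'v set \<Rightarrow> 'v bfun set" where
  "bfuns W = {f. \<forall>a b. (\<forall>w\<in>W. a w = b w) \<longrightarrow> f a = f b}"

definition supp :: "'v bfun \<Rightarrow> 'v set" where
  "supp f = {v. \<exists>a. f (a(v := True)) \<noteq> f (a(v := False))}"

definition candidates :: "'v set \<Rightarrow> 'v dqbf \<Rightarrow> ('v \<Rightarrow> 'v bfun) set" where
  "candidates V \<psi> =
     {s \<in> (free_vars V \<psi> \<union> ex_vars \<psi>) \<rightarrow>\<^sub>E bfuns (all_vars \<psi>).
        (\<forall>v\<in>free_vars V \<psi>. \<exists>c. s v = (\<lambda>_. c)) \<and>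
        (\<forall>v\<in>ex_vars \<psi>. supp (s v) \<subseteq> dep \<psi> v \<inter> all_vars \<psi>)}"

(* The Boolean function denoted by the formula that arises from deleting all quantifiers and
   replacing each variable v in W by s v. *)
primrec replace_vars :: "'v set \<Rightarrow> ('v \<Rightarrow> 'v bfun) \<Rightarrow> 'v dqbf \<Rightarrow> 'v bfun" where
  "replace_vars W s (Pos v) = (\<lambda>a. if v \<in> W then s v a else a v)"
| "replace_vars W s (Neg v) = (\<lambda>a. \<not> (if v \<in> W then s v a else a v))"
| "replace_vars W s (And \<phi>1 \<phi>2) = (\<lambda>a. replace_vars W s \<phi>1 a \<and> replace_vars W s \<phi>2 a)"
| "replace_vars W s (Or \<phi>1 \<phi>2) = (\<lambda>a. replace_vars W s \<phi>1 a \<or> replace_vars W s \<phi>2 a)"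
| "replace_vars W s (Exists v D \<phi>) = replace_vars W s \<phi>"
| "replace_vars W s (Forall v \<phi>) = replace_vars W s \<phi>"

definition apply_cand :: "'v set \<Rightarrow> ('v \<Rightarrow> 'v bfun) \<Rightarrow> 'v dqbf \<Rightarrow> 'v bfun" where
  "apply_cand V s \<psi> = replace_vars (free_vars V \<psi> \<union> ex_vars \<psi>) s \<psi>"

definition tautology :: "'v bfun \<Rightarrow> bool" where
  "tautology f \<longleftrightarrow> (\<forall>a. f a)"

definition skolem :: "'v set \<Rightarrow> 'v dqbf \<Rightarrow> ('v \<Rightarrow> 'v bfun) set" where
  "skolem V \<psi> = {s \<in> candidates V \<psi>. tautology (apply_cand V s \<psi>)}"

(* Each formula is read over its own ambient variable set, so that a formula may be compared
   with one that uses a variable from outside the original set. *)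
definition equisatisfiable :: "'v set \<Rightarrow> 'v dqbf \<Rightarrow> 'v set \<Rightarrow> 'v dqbf \<Rightarrow> bool" where
  "equisatisfiable V1 \<psi>1 V2 \<psi>2 \<longleftrightarrow> (skolem V1 \<psi>1 = {} \<longleftrightarrow> skolem V2 \<psi>2 = {})"

(* subst \<phi> x' x replaces x by x' everywhere: in literals, quantifiers and dependency sets *)
primrec subst :: "'v dqbf \<Rightarrow> 'v \<Rightarrow> 'v \<Rightarrow> 'v dqbf" where
  "subst (Pos v) x' x = Pos (if v = x then x' else v)"
| "subst (Neg v) x' x = Neg (if v = x then x' else v)"
| "subst (And \<phi>1 \<phi>2) x' x = And (subst \<phi>1 x' x) (subst \<phi>2 x' x)"
| "subst (Or \<phi>1 \<phi>2) x' x = Or (subst \<phi>1 x' x) (subst \<phi>2 x' x)"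
| "subst (Exists v D \<phi>) x' x =
     Exists (if v = x then x' else v) ((\<lambda>u. if u = x then x' else u) ` D) (subst \<phi> x' x)"
| "subst (Forall v \<phi>) x' x = Forall (if v = x then x' else v) (subst \<phi> x' x)"

(* A subformula occurrence \<chi> of \<psi> is a decomposition \<psi> = fill C \<chi> with a one-hole context C;
   replacing this occurrence by \<chi>' gives fill C \<chi>'. *)
datatype 'v ctxt =
    Hole
  | AndL "'v ctxt" "'v dqbf"
  | AndR "'v dqbf" "'v ctxt"
  | OrL "'v ctxt" "'v dqbf"
  | OrR "'v dqbf" "'v ctxt"
  | ExistsC 'v "'v set" "'v ctxt"
  | ForallC 'v "'v ctxt"

primrec fill :: "'v ctxt \<Rightarrow> 'v dqbf \<Rightarrow> 'v dqbf" where
  "fill Hole \<chi> = \<chi>"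
| "fill (AndL C \<phi>) \<chi> = And (fill C \<chi>) \<phi>"
| "fill (AndR \<phi> C) \<chi> = And \<phi> (fill C \<chi>)"
| "fill (OrL C \<phi>) \<chi> = Or (fill C \<chi>) \<phi>"
| "fill (OrR \<phi> C) \<chi> = Or \<phi> (fill C \<chi>)"
| "fill (ExistsC v D C) \<chi> = Exists v D (fill C \<chi>)"
| "fill (ForallC v C) \<chi> = Forall v (fill C \<chi>)"

end

theory Submission imports Defs
begin

text \<open>
  Given a Skolem function for the split formula, evaluating it at assignments in which \<open>x'\<close> takes the
  value of \<open>x\<close> gives one for the original formula. Conversely, from a Skolem function for the
  original formula, let the existential variables of \<open>\<phi>2\<close> read \<open>x'\<close> in place of \<open>x\<close>. Fix an
  assignment \<open>a\<close> and let \<open>a2\<close> be \<open>a\<close> with \<open>x\<close> set to the value of \<open>x'\<close>. The context of the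
  rewritten subformula depends neither on \<open>x\<close> nor on \<open>x'\<close>, and it is monotone in the hole. The
  new subformula has the value of \<open>\<phi>1\<close> at \<open>a\<close> and \<open>\<phi>2\<close> at \<open>a2\<close>. If \<open>\<phi>1\<close> holds at \<open>a\<close>, compare
  with the original formula at \<open>a2\<close>, otherwise with the original formula at \<open>a\<close>, where the hole
  is false.
\<close>

section \<open>Variable sets, dependency sets and \<open>remove_dep\<close>\<close>

lemma dep_outside_ex_vars: "y \<notin> ex_vars \<phi> \<Longrightarrow> dep \<phi> y = {}"
  by (induction \<phi>) auto

lemma q_vars_simps [simp]:
  "q_vars (Pos v) = {}"
  "q_vars (Neg v) = {}"
  "q_vars (And \<phi>1 \<phi>2) = q_vars \<phi>1 \<union> q_vars \<phi>2"
  "q_vars (Or \<phi>1 \<phi>2) = q_vars \<phi>1 \<union> q_vars \<phi>2"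
  "q_vars (Exists v D \<phi>) = insert v (q_vars \<phi>)"
  "q_vars (Forall v \<phi>) = insert v (q_vars \<phi>)"
  by (auto simp: q_vars_def)

lemma ex_vars_subset_q_vars: "ex_vars \<phi> \<subseteq> q_vars \<phi>"
  by (simp add: q_vars_def)

lemma dep_vars_binary:
  "(\<Union>y\<in>ex_vars \<phi>1 \<union> ex_vars \<phi>2. dep \<phi>1 y \<union> dep \<phi>2 y) = dep_vars \<phi>1 \<union> dep_vars \<phi>2"
  unfolding dep_vars_def using dep_outside_ex_vars by fastforce

lemma dep_vars_simps [simp]:
  "dep_vars (Pos v) = {}"
  "dep_vars (Neg v) = {}"
  "dep_vars (And \<phi>1 \<phi>2) = dep_vars \<phi>1 \<union> dep_vars \<phi>2"
  "dep_vars (Or \<phi>1 \<phi>2) = dep_vars \<phi>1 \<union> dep_vars \<phi>2"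
  "dep_vars (Forall v \<phi>) = dep_vars \<phi>"
  using dep_vars_binary[of \<phi>1 \<phi>2] by (auto simp: dep_vars_def)

text \<open>A second binding of \<open>v\<close> inside \<open>\<phi>\<close> would be hidden by
  \<open>D\<close>, because \<open>dep\<close> returns the outermost annotation; the side condition
  excludes this.\<close>

lemma dep_vars_Exists [simp]:
  "v \<notin> q_vars \<phi> \<Longrightarrow> dep_vars (Exists v D \<phi>) = D \<union> dep_vars \<phi>"
  by (auto simp: dep_vars_def q_vars_def split: if_splits)

lemma remove_dep_vars [simp]:
  "ex_vars (remove_dep v \<phi>) = ex_vars \<phi>"
  "all_vars (remove_dep v \<phi>) = all_vars \<phi>"
  "fs_vars (remove_dep v \<phi>) = fs_vars \<phi>"
  "dep (remove_dep v \<phi>) y = dep \<phi> y - {v}"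
  by (induction \<phi>) auto

lemma remove_dep_q_vars [simp]: "q_vars (remove_dep v \<phi>) = q_vars \<phi>"
  by (simp add: q_vars_def)

lemma remove_dep_dep_vars [simp]: "dep_vars (remove_dep v \<phi>) = dep_vars \<phi> - {v}"
  by (auto simp: dep_vars_def)

section \<open>Structural characterisation of well-formedness\<close>

lemma remove_dep_commute: "remove_dep u (remove_dep v \<phi>) = remove_dep v (remove_dep u \<phi>)"
  by (induction \<phi>) auto

lemma remove_dep_idem [simp]: "remove_dep v (remove_dep v \<phi>) = remove_dep v \<phi>"
  by (induction \<phi>) auto

text \<open>In the existential case the body has the form \<open>remove_dep u \<phi>\<close>. For
  \<open>u = v\<close> idempotence suffices; otherwise \<open>v\<close> is absent from
  \<open>dep_vars \<phi>\<close> as well, and the two removals commute.\<close>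

lemma remove_dep_ident:
  assumes "\<phi> \<in> DQBF V" "v \<notin> dep_vars \<phi>"
  shows "remove_dep v \<phi> = \<phi>"
  using assms
proof (induction rule: DQBF.induct)
  case (exist \<phi> u D)
  then show ?case
    by (cases "u = v") (auto simp: free_vars_def remove_dep_commute[of v u])
qed auto

lemma remove_dep_DQBF:
  assumes "\<phi> \<in> DQBF V"
  shows "remove_dep v \<phi> \<in> DQBF V"
  using assms
proof (induction rule: DQBF.induct)
  case (exist \<phi> u D)
  have "Exists u (D - {v}) (remove_dep u (remove_dep v \<phi>)) \<in> DQBF V"
    using exist by (intro DQBF.exist) (auto simp: free_vars_def)
  then show ?case by (simp add: remove_dep_commute)
qed (auto intro!: DQBF.intros simp: compatible_def free_vars_def)

text \<open>Rule \<open>exist\<close> alters the body by \<open>remove_dep v\<close>. Expressing its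
  effect as a condition on the body as it stands makes structural induction on formulas available
  for well-formedness.\<close>

lemma DQBF_Exists_iff:
  "Exists v D \<phi> \<in> DQBF V \<longleftrightarrow>
     \<phi> \<in> DQBF V \<and> v \<in> V \<and> v \<notin> q_vars \<phi> \<and> D \<subseteq> V - (q_vars \<phi> \<union> {v}) \<and> v \<notin> dep_vars \<phi>"
  (is "?l \<longleftrightarrow> ?r")
proof
  assume ?l
  then show ?r
    by (rule DQBF.cases) (auto simp: free_vars_def remove_dep_DQBF)
next
  assume r: ?r
  then have "Exists v D (remove_dep v \<phi>) \<in> DQBF V"
    by (intro DQBF.exist) (auto simp: free_vars_def)
  then show ?l using r remove_dep_ident[of \<phi> V v] by simp
qed

lemma DQBF_simps [simp]:
  "Pos v \<in> DQBF V \<longleftrightarrow> v \<in> V"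
  "Neg v \<in> DQBF V \<longleftrightarrow> v \<in> V"
  "And \<phi>1 \<phi>2 \<in> DQBF V \<longleftrightarrow> \<phi>1 \<in> DQBF V \<and> \<phi>2 \<in> DQBF V \<and> compatible \<phi>1 \<phi>2"
  "Or \<phi>1 \<phi>2 \<in> DQBF V \<longleftrightarrow> \<phi>1 \<in> DQBF V \<and> \<phi>2 \<in> DQBF V \<and> compatible \<phi>1 \<phi>2"
  "Forall v \<phi> \<in> DQBF V \<longleftrightarrow> \<phi> \<in> DQBF V \<and> v \<in> V \<and> v \<notin> q_vars \<phi>"
  by (auto intro: DQBF.intros elim: DQBF.cases simp: free_vars_def)

lemma DQBF_ex_all_disjoint:
  "\<phi> \<in> DQBF V \<Longrightarrow> ex_vars \<phi> \<inter> all_vars \<phi> = {}"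
proof (induction rule: DQBF.induct)
  case (conj \<phi>1 \<phi>2)
  then show ?case unfolding compatible_def q_vars_def by auto
next
  case (disj \<phi>1 \<phi>2)
  then show ?case unfolding compatible_def q_vars_def by auto
qed (auto simp: free_vars_def q_vars_def)

lemma DQBF_mono:
  assumes "\<phi> \<in> DQBF V" "V \<subseteq> V'"
  shows "\<phi> \<in> DQBF V'"
  using assms
  by (induction \<phi> rule: dqbf.induct) (auto simp: DQBF_Exists_iff)

section \<open>Renaming a variable that is not quantified\<close>

abbreviation rename :: "'v \<Rightarrow> 'v \<Rightarrow> 'v \<Rightarrow> 'v" where
  "rename x' x \<equiv> (\<lambda>u. if u = x then x' else u)"

lemma subst_vars:
  assumes "x \<notin> q_vars \<phi>"
  shows subst_ex_vars: "ex_vars (subst \<phi> x' x) = ex_vars \<phi>"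
    and subst_all_vars: "all_vars (subst \<phi> x' x) = all_vars \<phi>"
    and subst_dep: "dep (subst \<phi> x' x) y = rename x' x ` dep \<phi> y"
  using assms by (induction \<phi>) auto

lemma subst_q_vars: "x \<notin> q_vars \<phi> \<Longrightarrow> q_vars (subst \<phi> x' x) = q_vars \<phi>"
  by (simp add: q_vars_def subst_ex_vars subst_all_vars)

lemma subst_dep_vars:
  assumes "x \<notin> q_vars \<phi>"
  shows "dep_vars (subst \<phi> x' x) = rename x' x ` dep_vars \<phi>"
  unfolding dep_vars_def image_UN subst_ex_vars[OF assms] subst_dep[OF assms] ..

text \<open>The condition on \<open>x'\<close> prevents capture: a quantifier over \<open>x'\<close>
  would bind the renamed occurrences of \<open>x\<close>.\<close>

lemma subst_fs_vars:
  assumes "x \<notin> q_vars \<phi>" "x' \<notin> q_vars \<phi>"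
  shows "fs_vars (subst \<phi> x' x) = rename x' x ` fs_vars \<phi>"
  using assms by (induction \<phi>) (auto simp: image_iff split: if_splits)

lemma subst_compatible:
  assumes "compatible \<phi>1 \<phi>2" "x \<notin> q_vars \<phi>1 \<union> q_vars \<phi>2" "x' \<notin> q_vars \<phi>1 \<union> q_vars \<phi>2"
  shows "compatible (subst \<phi>1 x' x) (subst \<phi>2 x' x)"
  using assms unfolding compatible_def
  by (auto simp: subst_q_vars subst_fs_vars subst_dep_vars)

lemma subst_DQBF:
  assumes "\<phi> \<in> DQBF V" "x \<notin> q_vars \<phi>" "x' \<notin> q_vars \<phi> \<union> dep_vars \<phi>"
  shows "subst \<phi> x' x \<in> DQBF (insert x' V)"
  using assms
  by (induction \<phi> rule: dqbf.induct)
    (auto simp: DQBF_Exists_iff subst_q_vars subst_dep_vars subst_compatible)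

section \<open>Evaluation without quantifiers\<close>

primrec lits :: "'v dqbf \<Rightarrow> 'v set" where
  "lits (Pos v) = {v}"
| "lits (Neg v) = {v}"
| "lits (And \<phi>1 \<phi>2) = lits \<phi>1 \<union> lits \<phi>2"
| "lits (Or \<phi>1 \<phi>2) = lits \<phi>1 \<union> lits \<phi>2"
| "lits (Exists v D \<phi>) = lits \<phi>"
| "lits (Forall v \<phi>) = lits \<phi>"

lemma lits_subset: "lits \<phi> \<subseteq> q_vars \<phi> \<union> fs_vars \<phi>"
  by (induction \<phi>) auto

lemma fs_vars_subset_lits: "fs_vars \<phi> \<subseteq> lits \<phi>"
  by (induction \<phi>) auto

text \<open>One assignment \<open>e\<close> merges Skolem values and universal values. Candidates
  over different domains are then compared simply by comparing \<open>e\<close> on the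
  literals.\<close>

primrec eval_skeleton :: "('v \<Rightarrow> bool) \<Rightarrow> 'v dqbf \<Rightarrow> bool" where
  "eval_skeleton e (Pos v) = e v"
| "eval_skeleton e (Neg v) = (\<not> e v)"
| "eval_skeleton e (And \<phi>1 \<phi>2) = (eval_skeleton e \<phi>1 \<and> eval_skeleton e \<phi>2)"
| "eval_skeleton e (Or \<phi>1 \<phi>2) = (eval_skeleton e \<phi>1 \<or> eval_skeleton e \<phi>2)"
| "eval_skeleton e (Exists v D \<phi>) = eval_skeleton e \<phi>"
| "eval_skeleton e (Forall v \<phi>) = eval_skeleton e \<phi>"

lemma replace_vars_eval_skeleton:
  "replace_vars W s \<phi> a = eval_skeleton (\<lambda>v. if v \<in> W then s v a else a v) \<phi>"
  by (induction \<phi>) auto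

lemma eval_skeleton_cong:
  "(\<And>v. v \<in> lits \<phi> \<Longrightarrow> e v = e' v) \<Longrightarrow> eval_skeleton e \<phi> = eval_skeleton e' \<phi>"
  by (induction \<phi>) auto

text \<open>No side condition against capture arises, since evaluation passes over
  quantifiers.\<close>

lemma eval_skeleton_subst:
  "eval_skeleton e (subst \<phi> x' x) = eval_skeleton (\<lambda>v. e (rename x' x v)) \<phi>"
  by (induction \<phi>) auto

primrec ctxt_lits :: "'v ctxt \<Rightarrow> 'v set" where
  "ctxt_lits Hole = {}"
| "ctxt_lits (AndL C \<phi>) = ctxt_lits C \<union> lits \<phi>"
| "ctxt_lits (AndR \<phi> C) = lits \<phi> \<union> ctxt_lits C"
| "ctxt_lits (OrL C \<phi>) = ctxt_lits C \<union> lits \<phi>"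
| "ctxt_lits (OrR \<phi> C) = lits \<phi> \<union> ctxt_lits C"
| "ctxt_lits (ExistsC v D C) = ctxt_lits C"
| "ctxt_lits (ForallC v C) = ctxt_lits C"

text \<open>Skeletons contain no negation above a literal, so the hole is a monotone position.\<close>

lemma eval_skeleton_fill_mono:
  assumes "eval_skeleton e (fill C \<chi>)"
    and "\<And>v. v \<in> ctxt_lits C \<Longrightarrow> e v = e' v"
    and "eval_skeleton e \<chi> \<Longrightarrow> eval_skeleton e' \<chi>'"
  shows "eval_skeleton e' (fill C \<chi>')"
  using assms(1,2)
proof (induction C)
  case (AndL C \<phi>)
  then show ?case using eval_skeleton_cong[of \<phi> e e'] by simp
next
  case (AndR \<phi> C)
  then show ?case using eval_skeleton_cong[of \<phi> e e'] by simp
next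
  case (OrL C \<phi>)
  then show ?case using eval_skeleton_cong[of \<phi> e e'] by auto
next
  case (OrR \<phi> C)
  then show ?case using eval_skeleton_cong[of \<phi> e e'] by auto
qed (use assms(3) in auto)

section \<open>Well-formed formulas with a hole\<close>

lemma lits_fill: "lits (fill C \<chi>) = ctxt_lits C \<union> lits \<chi>"
  by (induction C) auto

lemma ex_vars_fill_subset: "ex_vars \<chi> \<subseteq> ex_vars (fill C \<chi>)"
  by (induction C) auto

lemma q_vars_fill_subset: "q_vars \<chi> \<subseteq> q_vars (fill C \<chi>)"
  by (induction C) auto

lemma ex_vars_fill_cong: "ex_vars \<chi> = ex_vars \<chi>' \<Longrightarrow> ex_vars (fill C \<chi>) = ex_vars (fill C \<chi>')"
  by (induction C) auto

lemma all_vars_fill_insert: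
  "all_vars \<chi>' = insert z (all_vars \<chi>) \<Longrightarrow>
    all_vars (fill C \<chi>') = insert z (all_vars (fill C \<chi>))"
  by (induction C) auto

lemma dep_fill_cong: "dep \<chi> y = dep \<chi>' y \<Longrightarrow> dep (fill C \<chi>) y = dep (fill C \<chi>') y"
  by (induction C) auto

lemma fill_DQBF_hole: "fill C \<chi> \<in> DQBF V \<Longrightarrow> \<chi> \<in> DQBF V"
  by (induction C) (auto simp: DQBF_Exists_iff)

lemma fill_DQBF_ctxt_lits:
  assumes "fill C \<chi> \<in> DQBF V"
  shows "ctxt_lits C \<inter> q_vars \<chi> = {}"
  using assms
proof (induction C)
  case (AndL C \<phi>)
  then show ?case using q_vars_fill_subset[of \<chi> C] lits_subset[of \<phi>]
    by (simp add: compatible_def) blast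
next
  case (AndR \<phi> C)
  then show ?case using q_vars_fill_subset[of \<chi> C] lits_subset[of \<phi>]
    by (simp add: compatible_def) blast
next
  case (OrL C \<phi>)
  then show ?case using q_vars_fill_subset[of \<chi> C] lits_subset[of \<phi>]
    by (simp add: compatible_def) blast
next
  case (OrR \<phi> C)
  then show ?case using q_vars_fill_subset[of \<chi> C] lits_subset[of \<phi>]
    by (simp add: compatible_def) blast
qed (auto simp: DQBF_Exists_iff)

text \<open>Well-formedness forbids binding \<open>y\<close> again outside the hole, so at each
  binary node the other branch contributes the empty set, and no outer \<open>Exists\<close>
  overrides the annotation.\<close>

lemma fill_DQBF_dep_inner:
  assumes "fill C \<chi> \<in> DQBF V" "y \<in> ex_vars \<chi>"
  shows "dep (fill C \<chi>) y = dep \<chi> y"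
proof -
  have y: "y \<in> q_vars (fill C \<chi>)" for C
    using assms(2) q_vars_fill_subset ex_vars_subset_q_vars by fastforce
  have none: "dep \<phi> y = {}" if "y \<notin> q_vars \<phi>" for \<phi>
    using that by (simp add: dep_outside_ex_vars q_vars_def)
  show ?thesis
    using assms(1)
  proof (induction C)
    case (AndL C \<phi>)
    then show ?case using y[of C] none[of \<phi>]
      by (simp add: compatible_def) blast
  next
    case (AndR \<phi> C)
    then show ?case using y[of C] none[of \<phi>]
      by (simp add: compatible_def) blast
  next
    case (OrL C \<phi>)
    then show ?case using y[of C] none[of \<phi>]
      by (simp add: compatible_def) blast
  next
    case (OrR \<phi> C)
    then show ?case using y[of C] none[of \<phi>]
      by (simp add: compatible_def) blast
  qed (use y in \<open>auto simp: DQBF_Exists_iff\<close>)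
qed

lemma dep_subset_dep_vars: "dep \<phi> y \<subseteq> dep_vars \<phi>"
  using dep_outside_ex_vars unfolding dep_vars_def by fastforce

lemma fill_DQBF_dep_vars_subset:
  assumes "fill C \<chi> \<in> DQBF V"
  shows "dep_vars \<chi> \<subseteq> dep_vars (fill C \<chi>)"
  using fill_DQBF_dep_inner[OF assms] ex_vars_fill_subset[of \<chi> C] unfolding dep_vars_def by blast

text \<open>Compatibility separates dependency sets in one branch from quantifiers in the other, and
  the annotation of an enclosing \<open>Exists\<close> avoids everything quantified in its body.
  Hence nothing bound outside the hole can see a variable bound inside it.\<close>

lemma fill_DQBF_dep_outer:
  assumes "fill C \<chi> \<in> DQBF V" "y \<notin> ex_vars \<chi>"
  shows "dep (fill C \<chi>) y \<inter> q_vars \<chi> = {}"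
  using assms
proof (induction C)
  case Hole
  then show ?case by (simp add: dep_outside_ex_vars)
next
  case (AndL C \<phi>)
  then show ?case using q_vars_fill_subset[of \<chi> C] dep_subset_dep_vars[of \<phi> y]
    by (simp add: compatible_def) blast
next
  case (AndR \<phi> C)
  then show ?case using q_vars_fill_subset[of \<chi> C] dep_subset_dep_vars[of \<phi> y]
    by (simp add: compatible_def) blast
next
  case (OrL C \<phi>)
  then show ?case using q_vars_fill_subset[of \<chi> C] dep_subset_dep_vars[of \<phi> y]
    by (simp add: compatible_def) blast
next
  case (OrR \<phi> C)
  then show ?case using q_vars_fill_subset[of \<chi> C] dep_subset_dep_vars[of \<phi> y]
    by (simp add: compatible_def) blast
next
  case (ExistsC v D C)
  then show ?case using q_vars_fill_subset[of \<chi> C] by (auto simp: DQBF_Exists_iff)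
qed auto

text \<open>The sets of the filled formula gain at most the fresh \<open>z\<close>, so every
  disjointness condition along the context survives. The statements about these sets are part of the
  conclusion because the induction needs them to recheck compatibility.\<close>

lemma fill_DQBF_replace:
  assumes "fill C \<chi> \<in> DQBF V" "\<chi>' \<in> DQBF V'" "V \<subseteq> V'"
    and "q_vars \<chi>' = insert z (q_vars \<chi>)" "fs_vars \<chi>' = fs_vars \<chi>"
    and "dep_vars \<chi>' \<subseteq> insert z (dep_vars \<chi>)"
    and "z \<notin> vars (fill C \<chi>) \<union> dep_vars (fill C \<chi>)"
  shows "fill C \<chi>' \<in> DQBF V' \<and> q_vars (fill C \<chi>') = insert z (q_vars (fill C \<chi>)) \<and>
    fs_vars (fill C \<chi>') = fs_vars (fill C \<chi>) \<and>
    dep_vars (fill C \<chi>') \<subseteq> insert z (dep_vars (fill C \<chi>))"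
  using assms(1,7)
proof (induction C)
  case Hole
  then show ?case using assms by simp
next
  case (AndL C \<phi>)
  then have "z \<notin> vars (fill C \<chi>) \<union> dep_vars (fill C \<chi>)" "\<phi> \<in> DQBF V'"
    using DQBF_mono assms(3) by (auto simp: vars_def)
  with AndL show ?case by (auto simp: compatible_def vars_def)
next
  case (AndR \<phi> C)
  then have "z \<notin> vars (fill C \<chi>) \<union> dep_vars (fill C \<chi>)" "\<phi> \<in> DQBF V'"
    using DQBF_mono assms(3) by (auto simp: vars_def)
  with AndR show ?case by (auto simp: compatible_def vars_def)
next
  case (OrL C \<phi>)
  then have "z \<notin> vars (fill C \<chi>) \<union> dep_vars (fill C \<chi>)" "\<phi> \<in> DQBF V'"
    using DQBF_mono assms(3) by (auto simp: vars_def)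
  with OrL show ?case by (auto simp: compatible_def vars_def)
next
  case (OrR \<phi> C)
  then have "z \<notin> vars (fill C \<chi>) \<union> dep_vars (fill C \<chi>)" "\<phi> \<in> DQBF V'"
    using DQBF_mono assms(3) by (auto simp: vars_def)
  with OrR show ?case by (auto simp: compatible_def vars_def)
next
  case (ExistsC v D C)
  then have v: "v \<notin> q_vars (fill C \<chi>)" "z \<noteq> v" "z \<notin> D"
    and z: "z \<notin> dep_vars (fill C \<chi>)"
    by (auto simp: DQBF_Exists_iff vars_def)
  \<comment> \<open>Binding \<open>v\<close> deletes it from \<open>fs_vars\<close>, so freshness
    for the body uses \<open>z \<noteq> v\<close>.\<close>
  have "z \<notin> fs_vars (fill C \<chi>)" using ExistsC.prems v by (auto simp: vars_def)
  then have "z \<notin> vars (fill C \<chi>) \<union> dep_vars (fill C \<chi>)"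
    using ExistsC.prems z by (auto simp: vars_def)
  with ExistsC v assms(3) show ?case by (auto simp: DQBF_Exists_iff)
next
  case (ForallC v C)
  then have v: "z \<noteq> v" by (auto simp: vars_def)
  then have "z \<notin> vars (fill C \<chi>) \<union> dep_vars (fill C \<chi>)"
    using ForallC.prems by (auto simp: vars_def)
  with ForallC v assms(3) show ?case by auto
qed

section \<open>Supports under substitution of one variable for another\<close>

lemma notin_supp_upd: "v \<notin> supp f \<Longrightarrow> f (a(v := b)) = f (a(v := c))"
  unfolding supp_def by (cases b; cases c) auto

lemma supp_upd_eq: "v \<notin> supp f \<Longrightarrow> f (a(v := b)) = f a"
  using notin_supp_upd[of v f a b "a v"] by simp

text \<open>The new function reads \<open>w\<close> wherever \<open>f\<close> reads
  \<open>u\<close>, so the support can at most trade \<open>u\<close> for \<open>w\<close>.\<close>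

lemma supp_substitute:
  "supp (\<lambda>a. f (a(u := a w))) \<subseteq> rename w u ` supp f"
proof
  fix v assume "v \<in> supp (\<lambda>a. f (a(u := a w)))"
  then obtain a where a: "f ((a(v := True))(u := (a(v := True)) w)) \<noteq>
      f ((a(v := False))(u := (a(v := False)) w))"
    unfolding supp_def by auto
  show "v \<in> rename w u ` supp f"
  proof (rule ccontr)
    assume n: "v \<notin> rename w u ` supp f"
    have v: "v = u \<or> v \<notin> supp f" using n by force
    have u: "v \<noteq> w \<or> u \<notin> supp f" using n by force
    \<comment> \<open>The variable \<open>v\<close> can act directly as an argument of
      \<open>f\<close>, or through the value of \<open>w\<close> copied into \<open>u\<close>. The
      fact \<open>v\<close> closes the first channel and the fact \<open>u\<close> the
      second.\<close>
    have upd: "f ((a(v := b))(u := (a(v := b)) w)) = f (a(u := (a(v := c)) w))" for b c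
    proof -
      have "f ((a(v := b))(u := (a(v := b)) w)) = f (a(u := (a(v := b)) w))"
      proof (cases "v = u")
        case False
        then show ?thesis using v supp_upd_eq[of v f "a(u := (a(v := b)) w)" b]
          by (simp add: fun_upd_twist)
      qed simp
      also have "\<dots> = f (a(u := (a(v := c)) w))"
        using u notin_supp_upd[of u f a "(a(v := b)) w" "(a(v := c)) w"] by (cases "v = w") auto
      finally show ?thesis .
    qed
    show False using a upd[of True True] upd[of False True] by simp
  qed
qed

section \<open>Well-formedness and variable sets of the split formula\<close>

locale forall_split =
  fixes V :: "'v set" and C :: "'v ctxt" and \<phi>1 \<phi>2 :: "'v dqbf" and x x' :: 'v
  assumes DQBF: "fill C (Forall x (And \<phi>1 \<phi>2)) \<in> DQBF V"
    and fresh: "x' \<notin> vars (fill C (Forall x (And \<phi>1 \<phi>2)))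
                  \<union> dep_vars (fill C (Forall x (And \<phi>1 \<phi>2)))"
begin

abbreviation "\<psi>1 \<equiv> Forall x (And \<phi>1 \<phi>2)"
abbreviation "\<psi>2 \<equiv> And (Forall x \<phi>1) (Forall x' (subst \<phi>2 x' x))"
abbreviation "\<psi> \<equiv> fill C \<psi>1"
abbreviation "\<psi>' \<equiv> fill C \<psi>2"
abbreviation "V' \<equiv> insert x' V"

lemma hole_DQBF:
  "\<phi>1 \<in> DQBF V" "\<phi>2 \<in> DQBF V" "compatible \<phi>1 \<phi>2"
  "x \<in> V" "x \<notin> q_vars \<phi>1" "x \<notin> q_vars \<phi>2"
  using fill_DQBF_hole[OF DQBF] by auto

lemma q_vars_hole: "x \<in> q_vars \<psi>" "q_vars \<phi>1 \<subseteq> q_vars \<psi>" "q_vars \<phi>2 \<subseteq> q_vars \<psi>"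
  using q_vars_fill_subset[of \<psi>1 C] by auto

lemma x_universal: "x \<in> all_vars \<psi>" "x \<notin> ex_vars \<psi>"
proof -
  have "all_vars \<psi>1 \<subseteq> all_vars \<psi>" by (induction C) auto
  then show "x \<in> all_vars \<psi>" by auto
  then show "x \<notin> ex_vars \<psi>" using DQBF_ex_all_disjoint[OF DQBF] by auto
qed

text \<open>Freshness for \<open>dep_vars\<close> is a separate part of the assumption because
  \<open>vars\<close> does not see variables mentioned only in dependency sets.\<close>

lemma fresh_q: "x' \<notin> q_vars \<psi>"
  and fresh_dep: "x' \<notin> dep_vars \<psi>"
  and fresh_lits: "x' \<notin> lits \<psi>"
  and fresh_neq: "x' \<noteq> x"
  and fresh_ex: "x' \<notin> ex_vars \<psi>"
  using fresh lits_subset[of \<psi>] q_vars_hole(1) by (auto simp: vars_def q_vars_def)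

lemma fresh_hole:
  "x' \<notin> q_vars \<phi>1" "x' \<notin> q_vars \<phi>2" "x' \<notin> fs_vars \<phi>1" "x' \<notin> fs_vars \<phi>2"
  "x' \<notin> dep_vars \<phi>1" "x' \<notin> dep_vars \<phi>2" "x' \<notin> ctxt_lits C" "x' \<notin> lits \<phi>1" "x' \<notin> lits \<phi>2"
  using fresh_q fresh_lits fresh_dep q_vars_hole fill_DQBF_dep_vars_subset[OF DQBF]
    fs_vars_subset_lits[of \<phi>1] fs_vars_subset_lits[of \<phi>2]
  by (auto simp: lits_fill)

text \<open>Renaming removes \<open>x\<close> from the right conjunct, and \<open>x'\<close> is
  fresh for the left one, so the two new quantifiers do not interfere.\<close>

lemma split_DQBF: "\<psi>2 \<in> DQBF V'"
proof -
  have "compatible (Forall x \<phi>1) (Forall x' (subst \<phi>2 x' x))"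
    using hole_DQBF fresh_hole fresh_neq unfolding compatible_def
    by (auto simp: subst_q_vars subst_fs_vars subst_dep_vars)
  moreover have "\<phi>1 \<in> DQBF V'"
    using DQBF_mono hole_DQBF(1) by blast
  moreover have "subst \<phi>2 x' x \<in> DQBF V'"
    using hole_DQBF fresh_hole by (intro subst_DQBF) auto
  ultimately show ?thesis
    using hole_DQBF fresh_hole by (simp add: subst_q_vars)
qed

lemma result_DQBF: "\<psi>' \<in> DQBF V'"
  and result_q_vars: "q_vars \<psi>' = insert x' (q_vars \<psi>)"
proof -
  have "fs_vars \<psi>2 = fs_vars \<psi>1"
    using hole_DQBF fresh_hole by (auto simp: subst_fs_vars)
  moreover have "q_vars \<psi>2 = insert x' (q_vars \<psi>1)"
    using hole_DQBF by (auto simp: subst_q_vars)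
  moreover have "dep_vars \<psi>2 \<subseteq> insert x' (dep_vars \<psi>1)"
    using hole_DQBF by (auto simp: subst_dep_vars)
  ultimately show "\<psi>' \<in> DQBF V'" "q_vars \<psi>' = insert x' (q_vars \<psi>)"
    using fill_DQBF_replace[OF DQBF split_DQBF _ _ _ _ fresh] by auto
qed

lemma result_ex_vars: "ex_vars \<psi>' = ex_vars \<psi>"
  by (rule ex_vars_fill_cong) (simp add: subst_ex_vars hole_DQBF)

lemma result_all_vars: "all_vars \<psi>' = insert x' (all_vars \<psi>)"
  by (rule all_vars_fill_insert) (auto simp: subst_all_vars hole_DQBF)

text \<open>If \<open>x'\<close> already belongs to \<open>V\<close>, it is free in
  \<open>\<psi>\<close> but becomes bound in \<open>\<psi>'\<close>; otherwise the difference
  removes nothing.\<close>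

lemma result_free_vars: "free_vars V' \<psi>' = free_vars V \<psi> - {x'}"
  by (auto simp: free_vars_def result_q_vars)

lemma ex_vars_disjoint: "ex_vars \<phi>1 \<inter> ex_vars \<phi>2 = {}"
  using hole_DQBF(3) ex_vars_subset_q_vars[of \<phi>1] ex_vars_subset_q_vars[of \<phi>2]
  by (auto simp: compatible_def)

lemma ex_vars_hole: "ex_vars \<phi>2 \<subseteq> ex_vars \<psi>"
  using ex_vars_fill_subset[of \<psi>1 C] by auto

text \<open>For \<open>y\<close> bound in \<open>\<phi>2\<close> the annotation in the hole decides.
  For any other \<open>y\<close> the formulas \<open>\<psi>1\<close> and \<open>\<psi>2\<close> have
  the same \<open>dep\<close>, and so do the filled formulas.\<close>

lemma result_dep:
  "dep \<psi>' y = (if y \<in> ex_vars \<phi>2 then rename x' x ` dep \<psi> y else dep \<psi> y)"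
proof (cases "y \<in> ex_vars \<phi>2")
  case True
  then have "dep \<phi>1 y = {}"
    using ex_vars_disjoint dep_outside_ex_vars by fastforce
  then show ?thesis
    using True fill_DQBF_dep_inner[OF DQBF, of y] fill_DQBF_dep_inner[OF result_DQBF, of y]
    by (simp add: subst_ex_vars subst_dep hole_DQBF)
next
  case False
  then show ?thesis
    using dep_fill_cong[of \<psi>1 y \<psi>2 C]
    by (simp add: subst_dep hole_DQBF dep_outside_ex_vars)
qed

lemma fresh_dep': "x' \<notin> dep \<psi> y"
  using fresh_dep dep_subset_dep_vars by fastforce

lemma x_dep: "y \<notin> ex_vars \<phi>1 \<Longrightarrow> y \<notin> ex_vars \<phi>2 \<Longrightarrow> x \<notin> dep \<psi> y"
  using fill_DQBF_dep_outer[OF DQBF, of y] by auto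

lemma lits_not_quantified:
  "v \<in> ctxt_lits C \<Longrightarrow> v \<noteq> x \<and> v \<notin> ex_vars \<phi>1 \<and> v \<notin> ex_vars \<phi>2"
  "v \<in> lits \<phi>1 \<Longrightarrow> v \<notin> ex_vars \<phi>2"
  "v \<in> lits \<phi>2 \<Longrightarrow> v \<notin> ex_vars \<phi>1"
  using fill_DQBF_ctxt_lits[OF DQBF] hole_DQBF(3) lits_subset[of \<phi>1] lits_subset[of \<phi>2]
    ex_vars_subset_q_vars[of \<phi>1] ex_vars_subset_q_vars[of \<phi>2]
  by (auto simp: compatible_def)

section \<open>Transfer of Skolem functions in both directions\<close>

abbreviation "W \<equiv> free_vars V \<psi> \<union> ex_vars \<psi>"
abbreviation "W' \<equiv> free_vars V' \<psi>' \<union> ex_vars \<psi>'"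

lemma W'_eq: "W' = W - {x'}"
  using fresh_ex by (auto simp: result_free_vars result_ex_vars)

lemma x_notin_W: "x \<notin> W"
  using x_universal q_vars_hole by (auto simp: free_vars_def)

lemma skolem_split:
  assumes s: "s \<in> skolem V \<psi>"
  defines "s' \<equiv> restrict (\<lambda>v. if v \<in> ex_vars \<phi>2 then (\<lambda>a. s v (a(x := a x'))) else s v) W'"
  shows "s' \<in> skolem V' \<psi>'"
proof -
  have bf: "s v \<in> bfuns (all_vars \<psi>)" if "v \<in> W" for v
    using s that unfolding skolem_def candidates_def by (auto simp: PiE_def Pi_def)
  have const: "\<exists>c. s v = (\<lambda>_. c)" if "v \<in> free_vars V \<psi>" for v
    using s that by (auto simp: skolem_def candidates_def)
  have supp: "supp (s v) \<subseteq> dep \<psi> v \<inter> all_vars \<psi>" if "v \<in> ex_vars \<psi>" for v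
    using s that by (auto simp: skolem_def candidates_def)
  have bf': "s' v \<in> bfuns (all_vars \<psi>')" if "v \<in> W'" for v
  proof -
    \<comment> \<open>On \<open>all_vars \<psi>\<close>, the assignment \<open>a(x := a x')\<close>
      is determined by \<open>a\<close> on \<open>insert x' (all_vars \<psi>)\<close>.\<close>
    have "s v \<in> bfuns (all_vars \<psi>)" using that bf W'_eq by auto
    then show ?thesis using that unfolding s'_def bfuns_def result_all_vars by auto
  qed
  have const': "\<exists>c. s' v = (\<lambda>_. c)" if "v \<in> free_vars V' \<psi>'" for v
    using const[of v] that unfolding s'_def by (auto simp: result_free_vars)
  have supp': "supp (s' v) \<subseteq> dep \<psi>' v \<inter> all_vars \<psi>'" if v: "v \<in> ex_vars \<psi>'" for v
  proof -
    have "v \<in> ex_vars \<psi>" using v result_ex_vars by simp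
    then have "supp (s v) \<subseteq> dep \<psi> v \<inter> all_vars \<psi>" using supp by blast
    \<comment> \<open>For \<open>v\<close> in \<open>ex_vars \<phi>2\<close>, the support trades
      \<open>x\<close> for \<open>x'\<close> just as \<open>result_dep\<close> does for the
      dependency set.\<close>
    then show ?thesis
      using v supp_substitute[of "s v" x x'] unfolding s'_def result_dep result_all_vars
      by (auto 0 3)
  qed
  have "s' \<in> candidates V' \<psi>'"
    unfolding candidates_def using bf' const' supp' by (auto simp: s'_def)
  moreover have "apply_cand V' s' \<psi>' a" for a
  proof -
    let ?a = "a(x := a x')"
    let ?e = "\<lambda>a v. if v \<in> W then s v a else a v"
    let ?e' = "\<lambda>v. if v \<in> W' then s' v a else a v"
    have taut: "eval_skeleton (?e a) \<psi>" for a
      using s unfolding skolem_def tautology_def apply_cand_def replace_vars_eval_skeleton by auto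
    have unchanged: "?e' v = ?e a v" if "v \<noteq> x'" "v \<notin> ex_vars \<phi>2" for v
      using that W'_eq by (simp add: s'_def)
    \<comment> \<open>Existential variables bound outside the hole cannot see \<open>x\<close> by
      \<open>x_dep\<close>, free variables have constant functions, and the remaining ones are read
      from \<open>a\<close> at a place other than \<open>x\<close>.\<close>
    have indep: "?e ?a v = ?e a v" if v: "v \<noteq> x" "v \<notin> ex_vars \<phi>1" "v \<notin> ex_vars \<phi>2" for v
    proof (cases "v \<in> ex_vars \<psi>")
      case True
      then have "x \<notin> supp (s v)" using supp x_dep v by blast
      then show ?thesis using True by (simp add: supp_upd_eq)
    next
      case False
      then show ?thesis using v const[of v] by auto
    qed
    have ctxt: "?e' v = ?e a v" "?e' v = ?e ?a v" if "v \<in> ctxt_lits C" for v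
      using that unchanged indep lits_not_quantified(1) fresh_hole(7) by metis+
    have left: "eval_skeleton ?e' \<phi>1 = eval_skeleton (?e a) \<phi>1"
      using unchanged lits_not_quantified(2) fresh_hole(8) by (intro eval_skeleton_cong) metis
    \<comment> \<open>The renamed variable reads \<open>a x'\<close>, which is the value of
      \<open>x\<close> under \<open>?a\<close>; the functions of \<open>\<phi>2\<close> were
      redefined to make the same shift.\<close>
    have right: "eval_skeleton ?e' (subst \<phi>2 x' x) = eval_skeleton (?e ?a) \<phi>2"
      unfolding eval_skeleton_subst
    proof (rule eval_skeleton_cong)
      fix v assume v: "v \<in> lits \<phi>2"
      then have vx': "v \<noteq> x'" using fresh_hole by auto
      consider "v = x" | "v \<in> ex_vars \<phi>2" "v \<noteq> x" | "v \<notin> ex_vars \<phi>2" "v \<noteq> x" by blast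
      then show "?e' (rename x' x v) = ?e ?a v"
      proof cases
        case 1
        then show ?thesis using x_notin_W W'_eq by auto
      next
        case 2
        then have "v \<in> W" "v \<in> W'" using ex_vars_hole W'_eq vx' by auto
        then show ?thesis using 2 by (simp add: s'_def)
      next
        case 3
        then show ?thesis
          using unchanged[OF vx'] indep lits_not_quantified(3)[OF v] by auto
      qed
    qed
    have "eval_skeleton ?e' \<psi>'"
    \<comment> \<open>The context may be satisfied with a false hole, so truth of the whole formula
      at \<open>a\<close> and at \<open>?a\<close> does not yield both conjuncts. In each case one
      of the two points gives an implication from \<open>\<psi>1\<close> to \<open>\<psi>2\<close>,
      and monotonicity applies.\<close>
    proof (cases "eval_skeleton (?e a) \<phi>1")
      case True
      then show ?thesis
        using left right ctxt(2) by (intro eval_skeleton_fill_mono[OF taut[of ?a]]) auto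
    next
      case False
      then show ?thesis
        using ctxt(1) by (intro eval_skeleton_fill_mono[OF taut[of a]]) auto
    qed
    then show ?thesis unfolding apply_cand_def replace_vars_eval_skeleton .
  qed
  ultimately show ?thesis unfolding skolem_def tautology_def by blast
qed

text \<open>All functions, not only those of \<open>\<phi>2\<close>, are evaluated at
  \<open>a(x' := a x)\<close>, which removes \<open>x'\<close> as an argument uniformly. If
  \<open>x'\<close> lies in \<open>V\<close>, it is free in \<open>\<psi>\<close> while
  \<open>s'\<close> has no value for it; the constant \<open>True\<close> is an arbitrary choice,
  harmless because \<open>x'\<close> does not occur.\<close>

lemma skolem_merge:
  assumes s': "s' \<in> skolem V' \<psi>'"
  defines "s \<equiv> restrict (\<lambda>v. if v = x' then (\<lambda>_. True) else (\<lambda>a. s' v (a(x' := a x)))) W"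
  shows "s \<in> skolem V \<psi>"
proof -
  have bf': "s' v \<in> bfuns (all_vars \<psi>')" if "v \<in> W'" for v
    using s' that unfolding skolem_def candidates_def by (auto simp: PiE_def Pi_def)
  have const': "\<exists>c. s' v = (\<lambda>_. c)" if "v \<in> free_vars V' \<psi>'" for v
    using s' that by (auto simp: skolem_def candidates_def)
  have supp': "supp (s' v) \<subseteq> dep \<psi>' v \<inter> all_vars \<psi>'" if "v \<in> ex_vars \<psi>'" for v
    using s' that by (auto simp: skolem_def candidates_def)
  have bf: "s v \<in> bfuns (all_vars \<psi>)" if v: "v \<in> W" for v
  proof (cases "v = x'")
    case False
    then have "s' v \<in> bfuns (all_vars \<psi>')" using v bf' W'_eq by auto
    \<comment> \<open>Since \<open>x\<close> is universal in \<open>\<psi>\<close>, the value copied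
      into \<open>x'\<close> is determined by \<open>a\<close> on
      \<open>all_vars \<psi>\<close>.\<close>
    then show ?thesis
      using v x_universal(1) False unfolding s_def bfuns_def result_all_vars by auto
  qed (use v in \<open>simp add: s_def bfuns_def\<close>)
  have const: "\<exists>c. s v = (\<lambda>_. c)" if v: "v \<in> free_vars V \<psi>" for v
    using const'[of v] v unfolding s_def by (cases "v = x'") (auto simp: result_free_vars)
  have supp: "supp (s v) \<subseteq> dep \<psi> v \<inter> all_vars \<psi>" if v: "v \<in> ex_vars \<psi>" for v
  proof -
    have "supp (s' v) \<subseteq> dep \<psi>' v \<inter> all_vars \<psi>'" "v \<noteq> x'"
      using v supp' result_ex_vars fresh_ex by auto
    moreover from this have "supp (s v) \<subseteq> rename x x' ` supp (s' v)"
      using v supp_substitute[of "s' v" x' x] unfolding s_def by simp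
    \<comment> \<open>As \<open>x'\<close> is absent from \<open>dep \<psi> v\<close>, renaming back
      undoes the renaming for variables of \<open>\<phi>2\<close> and is the identity on the other
      dependency sets.\<close>
    moreover have "rename x x' ` dep \<psi>' v \<subseteq> dep \<psi> v"
      using fresh_dep'[of v] by (auto simp: result_dep split: if_splits)
    moreover have "rename x x' ` all_vars \<psi>' \<subseteq> all_vars \<psi>"
      using x_universal(1) by (auto simp: result_all_vars)
    ultimately show ?thesis by blast
  qed
  have "s \<in> candidates V \<psi>"
    unfolding candidates_def using bf const supp by (auto simp: s_def)
  moreover have "apply_cand V s \<psi> a" for a
  proof -
    let ?a = "a(x' := a x)"
    let ?e = "\<lambda>v. if v \<in> W then s v a else a v"
    let ?e' = "\<lambda>v. if v \<in> W' then s' v ?a else ?a v"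
    have unchanged: "?e' v = ?e v" if "v \<noteq> x'" for v
      using that W'_eq by (simp add: s_def)
    \<comment> \<open>Both are universal values: \<open>x'\<close> reads \<open>?a x'\<close>, which
      is \<open>a x\<close>.\<close>
    have "?e' x' = ?e x" using W'_eq x_notin_W by auto
    then have renamed: "?e' (rename x' x v) = ?e v" if "v \<noteq> x'" for v
      using unchanged[OF that] by (cases "v = x") (simp_all only: refl if_True if_False)
    have "eval_skeleton ?e' \<psi>'"
      using s' unfolding skolem_def tautology_def apply_cand_def replace_vars_eval_skeleton by auto
    moreover have "eval_skeleton ?e' \<phi>1 = eval_skeleton ?e \<phi>1"
      using fresh_hole(8) by (intro eval_skeleton_cong unchanged) blast
    moreover have "eval_skeleton ?e' (subst \<phi>2 x' x) = eval_skeleton ?e \<phi>2"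
      unfolding eval_skeleton_subst
      using fresh_hole(9) by (intro eval_skeleton_cong renamed) blast
    moreover have "?e' v = ?e v" if "v \<in> ctxt_lits C" for v
      using that fresh_hole(7) by (intro unchanged) blast
    \<comment> \<open>Both conjuncts of \<open>\<psi>2\<close> under \<open>?e'\<close> match those
      of \<open>\<psi>1\<close> under \<open>?e\<close>, so one comparison suffices without a case
      distinction.\<close>
    ultimately have "eval_skeleton ?e \<psi>"
      by (elim eval_skeleton_fill_mono) (simp_all only: eval_skeleton.simps)
    then show ?thesis unfolding apply_cand_def replace_vars_eval_skeleton .
  qed
  ultimately show ?thesis unfolding skolem_def tautology_def by blast
qed

end

theorem theorem8:
  fixes V :: "'v set"
    and \<psi> \<psi>' \<psi>1 \<psi>2 \<phi>1 \<phi>2 :: "'v dqbf"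
    and C :: "'v ctxt"
    and x x' :: 'v
  assumes "finite V"
    and "\<psi> \<in> DQBF V"
    and "\<psi>1 = Forall x (And \<phi>1 \<phi>2)"
    and "\<psi> = fill C \<psi>1"
    and "x' \<notin> vars \<psi> \<union> dep_vars \<psi>"
    and "\<psi>2 = And (Forall x \<phi>1) (Forall x' (subst \<phi>2 x' x))"
    and "\<psi>' = fill C \<psi>2"
  shows "\<psi>' \<in> DQBF (insert x' V) \<and> equisatisfiable V \<psi> (insert x' V) \<psi>'"
proof -
  interpret forall_split V C \<phi>1 \<phi>2 x x'
    using assms by unfold_locales auto
  show ?thesis
    using result_DQBF skolem_split skolem_merge assms(3,4,6,7)
    unfolding equisatisfiable_def by blast
qed

end
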